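(* Let $\alpha,\eta>0$ be real, let $d\ge 3$ be an integer, and let $G=(V,E)$ be a $d$-regular graph on $n$ vertices. Let $f\in\mathbb{R}^V$ be an eigenvector of the adjacency matrix of $G$, normalized so that $\|f\|_2=1$, with eigenvalue $\lambda\le -(d-1)-\alpha$ and satisfying $$\|f\|_\infty\le \frac{\eta}{\sqrt n}.$$ Then $f$ has at least $$\frac{n}{(2\eta)^{2+\frac{\log(d-1)}{\log(1+\alpha/(d-1))}}}$$ nodal domains.
   Context: Graphs are finite and simple. A (weak) nodal domain of $f:V\to\mathbb{R}$ on $G=(V,E)$ is a maximal connected subgraph $S$ of $G$ such that $f(u)\ge 0$ for all $u\in S$ or $f(u)\le 0$ for all $u\in S$. *)

theory Defs
  imports "HOL-Analysis.Analysis" "Graph_Theory.Graph_Theory"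
begin

text \<open>
  A finite simple graph is a \<^locale>\<open>pair_graph\<close>, that is, a finite, loop-free, symmetric set of
  arcs \<open>(u, v)\<close>; an undirected edge is the pair of opposite arcs. Vertex vectors and matrices are
  indexed by a finite type \<open>'v\<close>, so the theorem assumes that \<open>pverts G = UNIV\<close> and the
  number of vertices is \<open>CARD('v)\<close>.
\<close>

text \<open>The out-degree in the symmetric digraph is the degree in the undirected graph.\<close>

definition regular_graph :: "'a pair_pre_digraph \<Rightarrow> nat \<Rightarrow> bool" where
  "regular_graph G d \<longleftrightarrow> (\<forall>v \<in> pverts G. out_degree (with_proj G) v = d)"

definition adjacency_matrix :: "('v::finite) pair_pre_digraph \<Rightarrow> real ^ 'v ^ 'v" where
  "adjacency_matrix G = (\<chi> u v. if u \<rightarrow>\<^bsub>with_proj G\<^esub> v then 1 else 0)"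

definition is_eigenvector :: "real ^ 'n ^ 'n \<Rightarrow> real ^ 'n \<Rightarrow> real \<Rightarrow> bool" where
  "is_eigenvector A f l \<longleftrightarrow> f \<noteq> 0 \<and> A *v f = l *\<^sub>R f"

text \<open>
  Requiring \<^const>\<open>symmetric\<close> makes \<open>S\<close> range over the subgraphs of the undirected graph rather than
  over all sub-digraphs. \<^const>\<open>Digraph_Component.connected\<close> includes that \<open>S\<close> has a vertex.
  Maximality is with respect to the whole disjunction of the two sign conditions.
\<close>

definition nodal_domains :: "'v pair_pre_digraph \<Rightarrow> real ^ 'v \<Rightarrow> ('v, 'v \<times> 'v) pre_digraph set" where
  "nodal_domains G f =
    {S. pre_digraph.max_subgraph (with_proj G)
          (\<lambda>S. symmetric S \<and> Digraph_Component.connected S \<and>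
               ((\<forall>u \<in> verts S. f $ u \<ge> 0) \<or> (\<forall>u \<in> verts S. f $ u \<le> 0))) S}"

end

theory Submission
  imports Defs
begin

text \<open>
  A vertex \<open>u\<close> with \<open>f u \<noteq> 0\<close> all of whose neighbours have strictly opposite sign is a nodal domain
  by itself. At any other vertex of the support some neighbour contributes to the eigenvalue equation
  with the wrong sign, so one of the remaining \<open>d - 1\<close> neighbours \<open>v\<close> has opposite sign and satisfies
  \<open>\<bar>f v\<bar> \<ge> (1 + \<alpha> / (d - 1)) \<bar>f u\<bar>\<close>. Starting at a vertex with \<open>\<bar>f u\<bar> \<ge> 1 / (2 \<surd>n)\<close>, such
  growth steps must end at a singleton domain after at most
  \<open>k = \<lfloor>log (2 \<eta>) / log (1 + \<alpha> / (d - 1))\<rfloor>\<close> steps, because \<open>\<bar>f\<bar> \<le> \<eta> / \<surd>n\<close>. At most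
  \<open>1 + d + d (d - 1) + \<dots> + d (d - 1)\<^bsup>k-1\<^esup> \<le> 3 (d - 1)\<^sup>k\<close> starting vertices end at a given singleton
  domain, while the normalization forces at least \<open>3 n / (2 \<eta>)\<^sup>2\<close> starting vertices.
\<close>

section \<open>Growth steps and the eigenvalue equation\<close>

locale eigenfunction_below =
  fixes E :: "('v::finite) rel" and d :: nat and f :: "'v \<Rightarrow> real" and l \<beta> :: real
  assumes sym_E: "sym E"
    and degree: "card (E `` {u}) = d"
    and degree_ge: "d \<ge> 3"
    and eigen: "(\<Sum>v\<in>E `` {u}. f v) = l * f u"
    and eigenvalue_le: "l \<le> - ((real d - 1) * (1 + \<beta>))"
    and \<beta>_pos: "\<beta> > 0"
begin

definition isolated :: "'v set" where
  "isolated = {u. f u \<noteq> 0 \<and> (\<forall>v\<in>E `` {u}. f u * f v < 0)}"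

definition grows :: "'v \<Rightarrow> 'v \<Rightarrow> bool" where
  "grows u v \<longleftrightarrow> v \<in> E `` {u} \<and> f u * f v < 0 \<and> (1 + \<beta>) * \<bar>f u\<bar> \<le> \<bar>f v\<bar>"

text \<open>Multiply the eigenvalue equation by \<open>f u\<close> and drop the nonnegative term of
  one neighbour \<open>w\<close>. If no neighbour grew, the other \<open>d - 1\<close> terms would
  each exceed \<open>- (1 + \<beta>) * (f u)\<^sup>2\<close>, and their sum would be too large for
  the bound on \<open>l\<close>.\<close>

lemma exists_grows:
  assumes nz: "f u \<noteq> 0" and "u \<notin> isolated"
  shows "\<exists>v. grows u v"
proof (rule ccontr)
  assume no: "\<nexists>v. grows u v"
  obtain w where w: "w \<in> E `` {u}" "f u * f w \<ge> 0"
    using assms by (auto simp: isolated_def not_less)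
  have lower: "f u * f v > - ((1 + \<beta>) * (f u)\<^sup>2)" if v: "v \<in> E `` {u}" for v
  proof (cases "f u * f v < 0")
    case True
    then have "\<bar>f v\<bar> < (1 + \<beta>) * \<bar>f u\<bar>"
      using no v by (auto simp: grows_def not_le)
    then have "\<bar>f u\<bar> * \<bar>f v\<bar> < \<bar>f u\<bar> * ((1 + \<beta>) * \<bar>f u\<bar>)"
      using nz by (intro mult_strict_left_mono) auto
    also have "\<bar>f u\<bar> * ((1 + \<beta>) * \<bar>f u\<bar>) = (1 + \<beta>) * (f u)\<^sup>2"
      by (metis abs_mult_self_eq mult.left_commute power2_eq_square)
    finally have "\<bar>f u * f v\<bar> < (1 + \<beta>) * (f u)\<^sup>2"
      by (simp only: abs_mult)
    then show ?thesis
      by linarith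
  next
    case False
    moreover have "(1 + \<beta>) * (f u)\<^sup>2 > 0"
      using nz \<beta>_pos by simp
    ultimately show ?thesis
      by linarith
  qed
  have card: "card (E `` {u} - {w}) = d - 1"
    using w degree by simp
  then have ne: "E `` {u} - {w} \<noteq> {}"
    using degree_ge by force
  have "- ((real d - 1) * (1 + \<beta>)) * (f u)\<^sup>2 = (\<Sum>v\<in>E `` {u} - {w}. - ((1 + \<beta>) * (f u)\<^sup>2))"
    using card degree_ge by (simp add: of_nat_diff)
  also have "\<dots> < (\<Sum>v\<in>E `` {u} - {w}. f u * f v)"
    using ne lower by (intro sum_strict_mono) auto
  also have "\<dots> \<le> (\<Sum>v\<in>E `` {u}. f u * f v)"
    using w by (simp add: sum.remove[of _ w])
  also have "\<dots> = l * (f u)\<^sup>2"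
    by (simp add: eigen power2_eq_square flip: sum_distrib_left)
  also have "\<dots> \<le> - ((real d - 1) * (1 + \<beta>)) * (f u)\<^sup>2"
    using eigenvalue_le by (intro mult_right_mono) auto
  finally show False
    by simp
qed

section \<open>Counting the starting vertices of growth paths\<close>

primrec level :: "nat \<Rightarrow> 'v set" where
  "level 0 = isolated"
| "level (Suc j) = {u. u \<notin> isolated \<and> (\<exists>v\<in>level j. grows u v)}"

text \<open>Predecessors are neighbours of opposite sign. A nonzero vertex outside
  \<open>isolated\<close> has a neighbour without opposite sign, which saves one; this is the source
  of the base \<open>d - 1\<close> in the final bound.\<close>

lemma card_predecessors:
  "card {u. grows u v} \<le> d"
  "v \<notin> isolated \<Longrightarrow> f v \<noteq> 0 \<Longrightarrow> card {u. grows u v} \<le> d - 1"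
proof -
  have sub: "{u. grows u v} \<subseteq> {u \<in> E `` {v}. f v * f u < 0}"
    using sym_E by (auto simp: grows_def mult.commute dest: symD)
  have "card {u. grows u v} \<le> card (E `` {v})"
    using sub by (intro card_mono) auto
  then show "card {u. grows u v} \<le> d"
    by (simp add: degree)
  assume "v \<notin> isolated" "f v \<noteq> 0"
  then obtain w where w: "w \<in> E `` {v}" "f v * f w \<ge> 0"
    by (auto simp: isolated_def not_less)
  have "card {u. grows u v} \<le> card (E `` {v} - {w})"
    using sub w by (intro card_mono) auto
  then show "card {u. grows u v} \<le> d - 1"
    using w by (simp add: degree)
qed

lemma card_level_Suc:
  assumes "\<And>v. v \<in> level j \<Longrightarrow> card {u. grows u v} \<le> m"
  shows "card (level (Suc j)) \<le> card (level j) * m"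
proof -
  have "card (level (Suc j)) \<le> card (\<Union>v\<in>level j. {u. grows u v})"
    by (intro card_mono) auto
  also have "\<dots> \<le> (\<Sum>v\<in>level j. card {u. grows u v})"
    by (intro card_UN_le) simp
  also have "\<dots> \<le> (\<Sum>v\<in>level j. m)"
    using assms by (intro sum_mono)
  finally show ?thesis
    by simp
qed

text \<open>Only the step into \<open>isolated\<close> can cost a factor \<open>d\<close>: vertices
  of all later levels lie outside \<open>isolated\<close>, so each further step backwards costs
  \<open>d - 1\<close>.\<close>

lemma card_level:
  "card (level (Suc j)) \<le> card isolated * (d * (d - 1) ^ j)"
proof (induction j)
  case 0
  show ?case
    using card_level_Suc[of 0 d] card_predecessors by simp
next
  case (Suc j)
  have "f v \<noteq> 0 \<and> v \<notin> isolated" if "v \<in> level (Suc j)" for v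
    using that by (auto simp: grows_def)
  then have "card (level (Suc (Suc j))) \<le> card (level (Suc j)) * (d - 1)"
    using card_predecessors(2) by (intro card_level_Suc) blast
  also have "\<dots> \<le> card isolated * (d * (d - 1) ^ j) * (d - 1)"
    using Suc.IH by (rule mult_right_mono) simp
  finally show ?case
    by (simp add: mult_ac)
qed

lemma card_levels:
  "card (\<Union>j\<le>k. level j) \<le> card isolated * (3 * (d - 1) ^ k)"
proof (induction k)
  case 0
  show ?case
    by simp
next
  case (Suc k)
  have "card (\<Union>j\<le>Suc k. level j)
      \<le> card (\<Union>j\<le>k. level j) + card (level (Suc k))"
    using card_Un_le[of "level (Suc k)" "\<Union>j\<le>k. level j"] by (simp only: atMost_Suc UN_insert)
  also have "\<dots> \<le> card isolated * (3 * (d - 1) ^ k) + card isolated * (d * (d - 1) ^ k)"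
    using Suc.IH card_level[of k] by linarith
  also have "\<dots> = card isolated * ((d + 3) * (d - 1) ^ k)"
    by (simp add: algebra_simps)
  \<comment> \<open>The constant 3 closes the induction because
    \<open>d + 3 \<le> 3 * (d - 1)\<close> amounts to \<open>d \<ge> 3\<close>.\<close>
  also have "\<dots> \<le> card isolated * ((3 * (d - 1)) * (d - 1) ^ k)"
    using degree_ge by (intro mult_left_mono mult_right_mono) auto
  finally show ?case
    by (simp add: mult_ac)
qed

text \<open>Every step gains a factor of at least \<open>1 + \<beta>\<close>, so
  \<open>k + 1\<close> steps would exceed \<open>M\<close>. The induction moves one factor from the
  power into \<open>\<bar>f v\<bar>\<close>.\<close>

lemma mem_levels:
  assumes bound: "\<And>v. \<bar>f v\<bar> \<le> M"
  shows "f u \<noteq> 0 \<Longrightarrow> M < \<bar>f u\<bar> * (1 + \<beta>) ^ Suc k \<Longrightarrow> u \<in> (\<Union>j\<le>k. level j)"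
proof (induction k arbitrary: u)
  case 0
  have "u \<in> isolated"
  proof (rule ccontr)
    assume "u \<notin> isolated"
    then obtain v where "grows u v"
      using exists_grows 0 by blast
    then show False
      using bound[of v] 0 by (simp add: grows_def mult.commute)
  qed
  then show ?case
    by simp
next
  case (Suc k)
  show ?case
  proof (cases "u \<in> isolated")
    case True
    then show ?thesis
      by (intro UN_I[of 0]) auto
  next
    case False
    then obtain v where v: "grows u v"
      using exists_grows Suc.prems by blast
    have "M < (1 + \<beta>) * \<bar>f u\<bar> * (1 + \<beta>) ^ Suc k"
      using Suc.prems by (simp add: mult_ac)
    also have "\<dots> \<le> \<bar>f v\<bar> * (1 + \<beta>) ^ Suc k"
      using v \<beta>_pos by (intro mult_right_mono) (auto simp: grows_def)
    finally have "v \<in> (\<Union>j\<le>k. level j)"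
      using v by (intro Suc.IH) (auto simp: grows_def)
    then obtain j where "j \<le> k" "v \<in> level j"
      by blast
    then show ?thesis
      using v False by (intro UN_I[of "Suc j"]) auto
  qed
qed

section \<open>Quantitative bound from the normalization\<close>

lemma card_isolated_ge:
  assumes bound: "\<And>v. \<bar>f v\<bar> \<le> \<eta> / sqrt (real CARD('v))"
    and norm: "(\<Sum>v\<in>UNIV. (f v)\<^sup>2) = 1"
    and "\<eta> > 0"
  shows "real (card isolated) \<ge> real CARD('v) / (2 * \<eta>) powr (2 + ln (real d - 1) / ln (1 + \<beta>))"
proof -
  define n where "n = real CARD('v)"
  have n: "n > 0"
    by (simp add: n_def)
  \<comment> \<open>With this threshold the vertices outside \<open>L\<close> carry at most 1/4 of
    the squared norm, which leaves 3/4 for \<open>L\<close>.\<close>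
  define L where "L = {v. \<bar>f v\<bar> \<ge> 1 / (2 * sqrt n)}"
  have sq: "(f v)\<^sup>2 \<le> \<eta>\<^sup>2 / n" for v
    using power_mono[OF bound[of v], of 2] n by (simp add: n_def power_divide)
  have small: "(f v)\<^sup>2 \<le> 1 / (4 * n)" if "v \<notin> L" for v
  proof -
    have "\<bar>f v\<bar> ^ 2 \<le> (1 / (2 * sqrt n)) ^ 2"
      using that by (intro power_mono) (auto simp: L_def)
    then show ?thesis
      using n by (simp add: power_divide power_mult_distrib)
  qed
  have "1 = (\<Sum>v\<in>L. (f v)\<^sup>2) + (\<Sum>v\<in>-L. (f v)\<^sup>2)"
    using sum.union_disjoint[of L "-L" "\<lambda>v. (f v)\<^sup>2"] norm by simp
  also have "\<dots> \<le> (\<Sum>v\<in>L. \<eta>\<^sup>2 / n) + (\<Sum>v\<in>-L. 1 / (4 * n))"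
    using sq small by (intro add_mono sum_mono) auto
  also have "(\<Sum>v\<in>-L. 1 / (4 * n)) \<le> (\<Sum>v\<in>(UNIV::'v set). 1 / (4 * n))"
    using n by (intro sum_mono2) auto
  also have "\<dots> = 1 / 4"
    using n by (simp add: n_def)
  finally have "1 \<le> (real (card L) * \<eta>\<^sup>2) / n + 1 / 4"
    by simp
  then have "3 / 4 \<le> (real (card L) * \<eta>\<^sup>2) / n"
    by linarith
  then have card_L: "3 * n \<le> 4 * \<eta>\<^sup>2 * real (card L)"
    using n by (simp add: pos_le_divide_eq mult_ac)
  \<comment> \<open>Normalization forces \<open>\<eta> \<ge> 1\<close>, so
    \<open>ln (2 * \<eta>)\<close> is positive and \<open>nat\<close> does not truncate in the
    definition of \<open>k\<close>.\<close>
  have "(\<Sum>v\<in>UNIV. (f v)\<^sup>2) \<le> (\<Sum>v\<in>(UNIV::'v set). \<eta>\<^sup>2 / n)"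
    by (intro sum_mono sq)
  also have "\<dots> = \<eta>\<^sup>2"
    using n by (simp add: n_def)
  finally have "1\<^sup>2 \<le> \<eta>\<^sup>2"
    by (simp only: norm one_power2)
  then have \<eta>: "1 \<le> \<eta>"
    using \<open>\<eta> > 0\<close> by (rule power2_le_imp_le[OF _ less_imp_le])

  \<comment> \<open>Here \<open>2 * \<eta>\<close> is the ratio of the sup bound to the threshold of
    \<open>L\<close>. Of \<open>k \<le> x < k + 1\<close>, the right half limits the path length and
    the left half bounds the count by \<open>(d - 1) powr x\<close>.\<close>
  define x where "x = ln (2 * \<eta>) / ln (1 + \<beta>)"
  have x0: "x \<ge> 0"
    using \<eta> \<beta>_pos by (simp add: x_def)
  define k where "k = nat \<lfloor>x\<rfloor>"
  have k: "real k \<le> x" "x < real (Suc k)"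
    using x0 unfolding k_def by linarith+
  have "2 * \<eta> = (1 + \<beta>) powr x"
    using \<eta> \<beta>_pos by (simp add: x_def powr_def)
  also have "\<dots> < (1 + \<beta>) powr real (Suc k)"
    using k \<beta>_pos by (intro powr_less_mono) auto
  also have "\<dots> = (1 + \<beta>) ^ Suc k"
    using \<beta>_pos by (intro powr_realpow) auto
  finally have grow: "2 * \<eta> < (1 + \<beta>) ^ Suc k" .
  have "L \<subseteq> (\<Union>j\<le>k. level j)"
  proof
    fix u assume u: "u \<in> L"
    have "\<eta> / sqrt n = 1 / (2 * sqrt n) * (2 * \<eta>)"
      by simp
    also have "\<dots> < 1 / (2 * sqrt n) * (1 + \<beta>) ^ Suc k"
      using grow n by (intro mult_strict_left_mono) auto
    also have "\<dots> \<le> \<bar>f u\<bar> * (1 + \<beta>) ^ Suc k"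
      using u \<beta>_pos by (intro mult_right_mono) (auto simp: L_def)
    finally have "\<eta> / sqrt n < \<bar>f u\<bar> * (1 + \<beta>) ^ Suc k" .
    moreover have "0 < 1 / (2 * sqrt n)"
      using n by simp
    then have "f u \<noteq> 0"
      using u by (auto simp: L_def)
    ultimately show "u \<in> (\<Union>j\<le>k. level j)"
      using mem_levels bound unfolding n_def by blast
  qed
  then have "card L \<le> card (\<Union>j\<le>k. level j)"
    by (intro card_mono) auto
  then have "card L \<le> card isolated * (3 * (d - 1) ^ k)"
    using card_levels by (rule order_trans)
  then have "real (card L) \<le> real (card isolated * (3 * (d - 1) ^ k))"
    by (simp only: of_nat_le_iff)
  also have "\<dots> = 3 * real (card isolated) * (real d - 1) ^ k"
    using degree_ge by (simp add: of_nat_diff)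
  also have "(real d - 1) ^ k = (real d - 1) powr real k"
    using degree_ge by (simp add: powr_realpow)
  also have "\<dots> \<le> (real d - 1) powr x"
    using k degree_ge by (intro powr_mono) auto
  finally have "real (card L) \<le> 3 * real (card isolated) * (real d - 1) powr x"
    by (simp only: mult_left_mono of_nat_0_le_iff mult_nonneg_nonneg zero_le_numeral)
  then have "4 * \<eta>\<^sup>2 * real (card L) \<le> 4 * \<eta>\<^sup>2 * (3 * real (card isolated) * (real d - 1) powr x)"
    by (rule mult_left_mono) simp
  \<comment> \<open>The 3 from the geometric sum cancels the 3 from the mass 3/4.\<close>
  with card_L have "n \<le> real (card isolated) * (4 * \<eta>\<^sup>2 * (real d - 1) powr x)"
    by (simp add: mult_ac)
  moreover have "(2 * \<eta>) powr (2 + ln (real d - 1) / ln (1 + \<beta>)) = 4 * \<eta>\<^sup>2 * (real d - 1) powr x"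
  proof -
    have "(2 * \<eta>) powr (ln (real d - 1) / ln (1 + \<beta>)) = (real d - 1) powr x"
      using \<eta> degree_ge by (simp add: powr_def x_def)
    moreover have "(2 * \<eta>) powr 2 = 4 * \<eta>\<^sup>2"
      using \<eta> by (simp add: powr_numeral power_mult_distrib)
    ultimately show ?thesis
      by (simp add: powr_add)
  qed
  moreover have "0 < 4 * \<eta>\<^sup>2 * (real d - 1) powr x"
    using \<eta> degree_ge by simp
  ultimately show ?thesis
    unfolding n_def[symmetric] by (simp only: pos_divide_le_eq)
qed

end

section \<open>Singleton nodal domains\<close>

text \<open>Finiteness matters since \<open>card\<close> is 0 on infinite sets. It holds because
  \<open>compatible\<close> fixes \<open>tail\<close> and \<open>head\<close>, so vertex and arc
  sets determine a subgraph.\<close>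

lemma finite_nodal_domains:
  assumes "pair_graph G"
  shows "finite (nodal_domains G f)"
proof (rule finite_subset)
  interpret pair_graph G by fact
  show "finite ((\<lambda>(V, A). \<lparr>verts = V, arcs = A, tail = fst, head = snd\<rparr>) `
      (Pow (pverts G) \<times> Pow (parcs G)))"
    using pair_finite_verts pair_finite_arcs by simp
  show "nodal_domains G f \<subseteq>
    (\<lambda>(V, A). \<lparr>verts = V, arcs = A, tail = fst, head = snd\<rparr>) ` (Pow (pverts G) \<times> Pow (parcs G))"
  proof
    fix S assume "S \<in> nodal_domains G f"
    then have "subgraph S (with_proj G)"
      by (simp add: nodal_domains_def pre_digraph.max_subgraph_def)
    then have "S = (\<lambda>(V, A). \<lparr>verts = V, arcs = A, tail = fst, head = snd\<rparr>) (verts S, arcs S)"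
      "(verts S, arcs S) \<in> Pow (pverts G) \<times> Pow (parcs G)"
      by (auto simp: subgraph_def compatible_def intro!: pre_digraph.equality)
    then show "S \<in> (\<lambda>(V, A). \<lparr>verts = V, arcs = A, tail = fst, head = snd\<rparr>) `
        (Pow (pverts G) \<times> Pow (parcs G))"
      by (rule image_eqI)
  qed
qed

lemma singleton_nodal_domain:
  assumes "pair_graph G"
    and u: "u \<in> pverts G" and opp: "\<And>v. (u, v) \<in> parcs G \<Longrightarrow> f $ u * f $ v < 0"
  shows "\<lparr>verts = {u}, arcs = {}, tail = fst, head = snd\<rparr> \<in> nodal_domains G f"
    (is "?S \<in> _")
proof -
  interpret pair_graph G by fact
  have wf: "wf_digraph (with_proj G)" "wf_digraph ?S"
    by unfold_locales auto
  have "subgraph ?S (with_proj G)"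
    using u wf by (simp add: subgraph_def compatible_def)
  moreover have "symmetric ?S"
    by (simp add: symmetric_def arcs_ends_def sym_def)
  moreover have "Digraph_Component.connected ?S"
    by (auto simp: Digraph_Component.connected_def strongly_connected_def reachable_def)
  moreover have "H = ?S"
    if H: "subgraph ?S H" "subgraph H (with_proj G)" "Digraph_Component.connected H"
      and sgn: "(\<forall>w\<in>verts H. f $ w \<ge> 0) \<or> (\<forall>w\<in>verts H. f $ w \<le> 0)" for H
  proof -
    have uH: "u \<in> verts H" and proj: "tail H = fst" "head H = snd" and wfH: "wf_digraph H"
      and arcs: "arcs H \<subseteq> parcs G"
      using H by (auto simp: subgraph_def compatible_def)
    interpret H: wf_digraph H by fact
    \<comment> \<open>A neighbour of \<open>u\<close> in \<open>G\<close> has strictly opposite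
      sign, so it cannot share the sign-constant \<open>H\<close> with \<open>u\<close>; symmetry of
      \<open>G\<close> covers incoming arcs.\<close>
    have no_arc: "(u, w) \<notin> arcs H \<and> (w, u) \<notin> arcs H" for w
    proof -
      have "w \<notin> verts H" if "(u, w) \<in> parcs G"
      proof
        assume "w \<in> verts H"
        then have "f $ u * f $ w \<ge> 0"
          using sgn uH by (auto intro: mult_nonneg_nonneg mult_nonpos_nonpos)
        then show False
          using opp[OF that] by simp
      qed
      moreover have "(w, u) \<in> parcs G \<Longrightarrow> (u, w) \<in> parcs G"
        using pair_sym_arcs by (auto simp: symmetric_def dest: symD)
      ultimately show ?thesis
        using arcs H.tail_in_verts[of "(w, u)"] H.head_in_verts[of "(u, w)"] by (auto simp: proj)
    qed
    have "v = u" if "v \<in> verts H" for v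
    proof -
      \<comment> \<open>Connectedness is reachability in the symmetric closure, and a nontrivial
        walk from \<open>u\<close> would start with an arc excluded by
        \<open>no_arc\<close>.\<close>
      have "u \<rightarrow>\<^sup>*\<^bsub>with_proj (mk_symmetric H)\<^esub> v"
        using H(3) uH that by (auto simp: Digraph_Component.connected_def)
      then consider "u = v" | w where "u \<rightarrow>\<^bsub>with_proj (mk_symmetric H)\<^esub> w"
        by (rule pre_digraph.converse_reachable_cases)
      then show ?thesis
        using no_arc by cases (auto simp: parcs_mk_symmetric proj)
    qed
    then have verts: "verts H = {u}"
      using uH by blast
    moreover have "arcs H = {}"
    proof (rule equals0I)
      fix e assume "e \<in> arcs H"
      moreover from this have "fst e = u"
        using H.tail_in_verts[of e] verts by (simp add: proj)
      ultimately show False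
        using no_arc[of "snd e"] by (metis prod.collapse)
    qed
    ultimately show ?thesis
      using proj by (intro pre_digraph.equality) auto
  qed
  ultimately show ?thesis
    by (auto simp: nodal_domains_def pre_digraph.max_subgraph_def)
qed

theorem proposition1p3:
  fixes \<alpha> \<eta> l :: real and d :: nat
    and G :: "('v::finite) pair_pre_digraph" and f :: "real ^ 'v"
  assumes "\<alpha> > 0" and "\<eta> > 0" and "d \<ge> 3"
    and "pair_graph G" and "pverts G = UNIV" and "regular_graph G d"
    and "is_eigenvector (adjacency_matrix G) f l"
    and "norm f = 1"
    and "l \<le> - (real d - 1) - \<alpha>"
    and "infnorm f \<le> \<eta> / sqrt (real CARD('v))"
  shows "real (card (nodal_domains G f)) \<ge>
    real CARD('v) / (2 * \<eta>) powr (2 + ln (real d - 1) / ln (1 + \<alpha> / (real d - 1)))"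
proof -
  interpret pair_graph G by fact
  interpret eigenfunction_below "parcs G" d "\<lambda>v. f $ v" l "\<alpha> / (real d - 1)"
  proof
    show "sym (parcs G)"
      using pair_sym_arcs by (simp add: symmetric_def)
    show "card (parcs G `` {u}) = d" for u
    proof -
      have "out_arcs (with_proj G) u = Pair u ` (parcs G `` {u})"
        by (auto simp: out_arcs_def)
      then have "out_degree (with_proj G) u = card (parcs G `` {u})"
        by (simp add: out_degree_def card_image inj_on_def)
      then show ?thesis
        using \<open>regular_graph G d\<close> \<open>pverts G = UNIV\<close> by (simp add: regular_graph_def)
    qed
    show "(\<Sum>v\<in>parcs G `` {u}. f $ v) = l * f $ u" for u
    proof -
      have "l * f $ u = (adjacency_matrix G *v f) $ u"
        using \<open>is_eigenvector _ f l\<close> by (simp add: is_eigenvector_def)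
      also have "\<dots> = (\<Sum>v\<in>UNIV. if v \<in> parcs G `` {u} then f $ v else 0)"
        by (auto simp: matrix_vector_mult_def adjacency_matrix_def intro!: sum.cong)
      also have "\<dots> = (\<Sum>v\<in>parcs G `` {u}. f $ v)"
        by (simp add: sum.If_cases Image_singleton)
      finally show ?thesis
        by simp
    qed
    have "(real d - 1) * (1 + \<alpha> / (real d - 1)) = real d - 1 + \<alpha>"
      using \<open>d \<ge> 3\<close> by (simp add: distrib_left)
    then show "l \<le> - ((real d - 1) * (1 + \<alpha> / (real d - 1)))"
      using \<open>l \<le> _\<close> by linarith
    show "\<alpha> / (real d - 1) > 0"
      using \<open>\<alpha> > 0\<close> \<open>d \<ge> 3\<close> by simp
  qed (fact \<open>d \<ge> 3\<close>)
  have "\<bar>f $ v\<bar> \<le> \<eta> / sqrt (real CARD('v))" for v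
    using component_le_infnorm_cart[of f v] \<open>infnorm f \<le> _\<close> by linarith
  moreover have "(\<Sum>v\<in>UNIV. (f $ v)\<^sup>2) = 1"
    using \<open>norm f = 1\<close> by (simp add: norm_vec_def L2_set_def)
  ultimately have "real CARD('v) / (2 * \<eta>) powr (2 + ln (real d - 1) / ln (1 + \<alpha> / (real d - 1)))
      \<le> real (card isolated)"
    using \<open>\<eta> > 0\<close> by (intro card_isolated_ge)
  also have "card isolated \<le> card (nodal_domains G f)"
  proof (rule card_inj_on_le)
    let ?S = "\<lambda>u. \<lparr>verts = {u}, arcs = {}, tail = fst, head = snd\<rparr>"
    show "inj_on ?S isolated"
      by (auto simp: inj_on_def)
    show "?S ` isolated \<subseteq> nodal_domains G f"
      using \<open>pverts G = UNIV\<close> by (auto simp: isolated_def intro!: singleton_nodal_domain \<open>pair_graph G\<close>)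
  qed (rule finite_nodal_domains, fact)
  finally show ?thesis
    by simp
qed

end
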